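(* If $D$ is a reachable oriented graph with order $n$ and maximum out-degree $\Delta^+$, and $k$ is a positive integer with $k \leq \Delta^+$, then \[ F_k(D) \leq \frac{(\Delta^+ - k)n + k}{\Delta^+}, \] and this inequality is sharp (there exist reachable oriented graphs for which equality holds).
   Context: An oriented graph is a digraph obtained from a simple graph by giving each edge exactly one direction; if $(u,v)$ is an arc, $v$ is an out-neighbor of $u$. $D$ is reachable if there is a vertex $v$ such that every other vertex is reachable from $v$ by a directed path. Oriented $k$-forcing: starting from a nonempty set $S$ of colored vertices, repeatedly, any colored vertex having at most $k$ non-colored out-neighbors forces all of them to become colored (all forcings in a step simultaneous), until no change occurs; $S$ is a $k$-forcing set if all vertices end up colored. $F_k(D)$ is the minimum size of a $k$-forcing set of $D$. *)

theory Defs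
  imports Complex_Main "Graph_Theory.Digraph"
begin

text \<open>
  The locale \<^locale>\<open>digraph\<close> already demands finiteness and excludes loops and parallel arcs, so
  antisymmetry of the arc relation is exactly what is missing for the digraph to arise from a
  simple graph by giving each edge one direction.
\<close>
definition oriented_graph :: "('a, 'b) pre_digraph \<Rightarrow> bool" where
  "oriented_graph D \<longleftrightarrow> digraph D \<and> (\<forall>u v. u \<rightarrow>\<^bsub>D\<^esub> v \<longrightarrow> \<not> v \<rightarrow>\<^bsub>D\<^esub> u)"

definition reachable_digraph :: "('a, 'b) pre_digraph \<Rightarrow> bool" where
  "reachable_digraph D \<longleftrightarrow> (\<exists>v\<in>verts D. \<forall>w\<in>verts D. v \<rightarrow>\<^sup>*\<^bsub>D\<^esub> w)"

definition order :: "('a, 'b) pre_digraph \<Rightarrow> nat" where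
  "order D = card (verts D)"

text \<open>Only meaningful for finite digraphs with at least one vertex, as \<^const>\<open>Max\<close> is
  unspecified on the empty set.\<close>
definition max_out_degree :: "('a, 'b) pre_digraph \<Rightarrow> nat" where
  "max_out_degree D = Max (out_degree D ` verts D)"

definition out_neighbors :: "('a, 'b) pre_digraph \<Rightarrow> 'a \<Rightarrow> 'a set" where
  "out_neighbors D v = {w. v \<rightarrow>\<^bsub>D\<^esub> w}"

text \<open>One simultaneous step, applied to the set \<open>C\<close> of currently colored vertices.\<close>
definition force_step :: "('a, 'b) pre_digraph \<Rightarrow> nat \<Rightarrow> 'a set \<Rightarrow> 'a set" where
  "force_step D k C =
     C \<union> (\<Union>v\<in>{v \<in> C. card (out_neighbors D v - C) \<le> k}. out_neighbors D v - C)"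

text \<open>The steps only ever add vertices, so on a finite digraph this union is the set at which
  the iteration becomes stationary.\<close>
definition finally_colored :: "('a, 'b) pre_digraph \<Rightarrow> nat \<Rightarrow> 'a set \<Rightarrow> 'a set" where
  "finally_colored D k S = (\<Union>t. (force_step D k ^^ t) S)"

definition k_forcing_set :: "('a, 'b) pre_digraph \<Rightarrow> nat \<Rightarrow> 'a set \<Rightarrow> bool" where
  "k_forcing_set D k S \<longleftrightarrow>
     S \<subseteq> verts D \<and> S \<noteq> {} \<and> finally_colored D k S = verts D"

text \<open>For a finite digraph with at least one vertex the minimum exists, since
  \<^term>\<open>verts D\<close> is itself a \<open>k\<close>-forcing set.\<close>
definition k_forcing_number :: "nat \<Rightarrow> ('a, 'b) pre_digraph \<Rightarrow> nat" where
  "k_forcing_number k D = Min (card ` {S. k_forcing_set D k S})"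

end

theory Submission
  imports Defs
begin

text \<open>
  Upper bound: grow a forcing set greedily from a root \<open>r\<close>. If the coloring gets stuck at
  \<open>C\<close>, reachability provides a colored vertex \<open>u\<close> with \<open>m > k\<close> non-colored
  out-neighbors; adding \<open>m - k\<close> of them to the initial set lets \<open>u\<close> force the others.
  So \<open>m - k\<close> new initial vertices pay for at least \<open>m \<le> \<Delta>\<close> newly colored ones, a ratio
  of at most \<open>(\<Delta> - k) / \<Delta>\<close>, and only the root is paid for in full.

  Sharpness: in the out-star with \<open>\<Delta>\<close> leaves the centre and at least \<open>\<Delta> - k\<close> leaves
  must be colored initially.
\<close>

section \<open>Iterated forcing steps in an arbitrary digraph\<close>

lemma force_step_increasing: "C \<subseteq> force_step D k C"
  by (auto simp: force_step_def)

lemma finally_colored_increasing: "S \<subseteq> finally_colored D k S"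
  unfolding finally_colored_def by (metis UN_upper UNIV_I funpow_0)

lemma funpow_force_step_mono:
  assumes "s \<le> t"
  shows "(force_step D k ^^ s) S \<subseteq> (force_step D k ^^ t) S"
  using assms
proof (induction rule: dec_induct)
  case (step t)
  then show ?case using force_step_increasing[of "(force_step D k ^^ t) S"] by auto
qed simp

text \<open>Transfers invariants of a single step to the final coloring. Closure under unions of
  arbitrary sequences is strong, but holds for the invariants of interest: lying inside a fixed set,
  omitting a fixed vertex, being equal to a fixed set.\<close>

lemma finally_colored_induct:
  assumes "P S" and "\<And>C. P C \<Longrightarrow> P (force_step D k C)"
    and "\<And>f :: nat \<Rightarrow> _. (\<And>t. P (f t)) \<Longrightarrow> P (\<Union>t. f t)"
  shows "P (finally_colored D k S)"
proof -
  have "P ((force_step D k ^^ t) S)" for t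
    by (induction t) (auto intro: assms)
  then show ?thesis unfolding finally_colored_def by (rule assms(3))
qed

text \<open>The iterates increase, so the latest of finitely many coloring times serves for all
  elements of \<open>X\<close> at once.\<close>

lemma finally_colored_capture:
  assumes "finite X" and "X \<subseteq> finally_colored D k S"
  shows "\<exists>t. X \<subseteq> (force_step D k ^^ t) S"
  using assms
proof (induction X)
  case (insert x X)
  then obtain s t where "X \<subseteq> (force_step D k ^^ s) S" "x \<in> (force_step D k ^^ t) S"
    by (auto simp: finally_colored_def)
  then have "insert x X \<subseteq> (force_step D k ^^ max s t) S"
    using funpow_force_step_mono[of s "max s t"] funpow_force_step_mono[of t "max s t"]
    by (meson insert_subset max.cobounded1 max.cobounded2 subset_iff)
  then show ?case ..
qed simp

section \<open>Forcing in a finite digraph and the greedy bound\<close>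

context fin_digraph
begin

lemma out_neighbors_eq: "out_neighbors G v = head G ` out_arcs G v"
  by (force simp: out_neighbors_def arcs_ends_def arc_to_ends_def)

lemma finite_out_neighbors: "finite (out_neighbors G v)"
  by (simp add: out_neighbors_eq finite_out_arcs)

lemma card_out_neighbors_le: "card (out_neighbors G v) \<le> out_degree G v"
  unfolding out_neighbors_eq out_degree_def by (simp add: card_image_le finite_out_arcs)

lemma out_neighbors_subset: "out_neighbors G v \<subseteq> verts G"
  by (auto simp: out_neighbors_eq)

lemma out_degree_le_max: "v \<in> verts G \<Longrightarrow> out_degree G v \<le> max_out_degree G"
  by (simp add: max_out_degree_def)

text \<open>A larger colored set leaves each vertex fewer non-colored out-neighbors, so whatever
  could force before still can.\<close>

lemma force_step_mono:
  assumes "C \<subseteq> C'"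
  shows "force_step G k C \<subseteq> force_step G k C'"
proof -
  have "card (out_neighbors G v - C') \<le> card (out_neighbors G v - C)" for v
    using assms finite_out_neighbors by (intro card_mono) auto
  then have "card (out_neighbors G v - C') \<le> k" if "card (out_neighbors G v - C) \<le> k" for v
    using that order_trans by blast
  then show ?thesis using assms by (auto simp: force_step_def)
qed

lemma finally_colored_subset_verts: "S \<subseteq> verts G \<Longrightarrow> finally_colored G k S \<subseteq> verts G"
  by (rule finally_colored_induct) (use out_neighbors_subset in \<open>auto simp: force_step_def\<close>)

text \<open>The final coloring is stationary: \<open>v\<close> would already have forced at some
  finite time.\<close>

lemma finally_colored_closed:
  assumes "v \<in> finally_colored G k S"
    and "card (out_neighbors G v - finally_colored G k S) \<le> k"
  shows "out_neighbors G v \<subseteq> finally_colored G k S"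
proof -
  let ?F = "finally_colored G k S" and ?I = "\<lambda>t. (force_step G k ^^ t) S"
  obtain t where t: "insert v (out_neighbors G v \<inter> ?F) \<subseteq> ?I t"
    using finally_colored_capture[of "insert v (out_neighbors G v \<inter> ?F)" G k S] assms(1)
    by (auto simp: finite_out_neighbors)
  have sub: "?I s \<subseteq> ?F" for s
    by (auto simp: finally_colored_def)
  \<comment> \<open>By time \<open>t\<close> every out-neighbor of \<open>v\<close> that is ever
    colored has been colored, so the count for the final set is the count at time
    \<open>t\<close>.\<close>
  have "out_neighbors G v - ?I t = out_neighbors G v - ?F"
    using t sub[of t] by auto
  then have "out_neighbors G v \<subseteq> ?I (Suc t)"
    using t assms(2) by (auto simp: force_step_def)
  then show ?thesis using sub by blast
qed

lemma finally_colored_mono: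
  assumes "S \<subseteq> S'"
  shows "finally_colored G k S \<subseteq> finally_colored G k S'"
proof -
  have "(force_step G k ^^ t) S \<subseteq> (force_step G k ^^ t) S'" for t
    by (induction t) (simp_all add: assms force_step_mono)
  then show ?thesis by (auto simp: finally_colored_def)
qed

text \<open>Multiplying out by \<open>d\<close> keeps the bound in the naturals. The greedy growth
  is phrased extremally: among the sets satisfying an invariant, one with the largest final coloring
  must color everything.\<close>

lemma exists_forcing_set_bound:
  assumes r: "r \<in> verts G" "\<And>w. w \<in> verts G \<Longrightarrow> r \<rightarrow>\<^sup>* w"
    and deg: "\<And>v. v \<in> verts G \<Longrightarrow> out_degree G v \<le> d" and "k \<le> d"
  shows "\<exists>S. k_forcing_set G k S \<and> d * card S \<le> (d - k) * card (verts G) + k"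
proof -
  let ?F = "finally_colored G k"
  \<comment> \<open>The goal with \<open>card (?F S)\<close> in place of
    \<open>card (verts G)\<close>; it becomes the goal once \<open>?F S\<close> is all of
    \<open>verts G\<close>.\<close>
  define P where
    "P S \<longleftrightarrow> r \<in> S \<and> S \<subseteq> verts G \<and> d * card S \<le> (d - k) * card (?F S) + k" for S
  have finF: "finite (?F S)" if "S \<subseteq> verts G" for S
    using finally_colored_subset_verts[OF that] finite_verts finite_subset by blast
  have "r \<in> ?F {r}" using finally_colored_increasing[of "{r}" G k] by blast
  then have "card {r} \<le> card (?F {r})"
    using r finF[of "{r}"] by (intro card_mono) auto
  then have "(d - k) * 1 \<le> (d - k) * card (?F {r})" by (intro mult_le_mono2) simp
  \<comment> \<open>The summand \<open>k\<close> makes up the difference between the cost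
    \<open>d\<close> of the root and the \<open>d - k\<close> allowed for one colored
    vertex.\<close>
  then have "d \<le> (d - k) * card (?F {r}) + k" using \<open>k \<le> d\<close> by linarith
  then have "P {r}" unfolding P_def using r by simp
  moreover have "\<forall>S. P S \<longrightarrow> card (?F S) < Suc (card (verts G))"
    unfolding P_def by (metis card_mono le_imp_less_Suc finally_colored_subset_verts finite_verts)
  ultimately have "\<exists>S. P S \<and> (\<forall>S'. P S' \<longrightarrow> card (?F S') \<le> card (?F S))"
    by (rule ex_has_greatest_nat[where k = "{r}" and b = "Suc (card (verts G))"])
  then obtain S where S: "P S" and max: "\<And>S'. P S' \<Longrightarrow> card (?F S') \<le> card (?F S)"
    by metis
  have sub: "?F S \<subseteq> verts G" and "S \<subseteq> ?F S"
    using S finally_colored_subset_verts finally_colored_increasing[of S G k] by (auto simp: P_def)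
  have closed: "out_neighbors G u \<subseteq> ?F S" if u: "u \<in> ?F S" for u
  proof (rule ccontr)
    assume nsub: "\<not> out_neighbors G u \<subseteq> ?F S"
    define N where "N = out_neighbors G u - ?F S"
    have finN: "finite N" by (simp add: N_def finite_out_neighbors)
    have "k < card N" using nsub finally_colored_closed[OF u] by (force simp: N_def)
    have "card N \<le> d"
      using card_mono[OF finite_out_neighbors, of N u] card_out_neighbors_le[of u] deg[of u] u sub
      by (force simp: N_def)
    obtain A where A: "A \<subseteq> N" "card A = card N - k" "finite A"
      using obtain_subset_with_card_n[of "card N - k" N] by auto
    let ?S' = "S \<union> A"
    have S': "r \<in> ?S'" "?S' \<subseteq> verts G"
      using S A out_neighbors_subset[of u] by (auto simp: P_def N_def)
    have FS: "?F S \<subseteq> ?F ?S'" by (rule finally_colored_mono) simp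
    have AF: "A \<subseteq> ?F ?S'" using finally_colored_increasing[of ?S' G k] by blast
    \<comment> \<open>Coloring \<open>A\<close> leaves just \<open>k\<close> vertices of
      \<open>N\<close>, few enough for \<open>u\<close> to force them.\<close>
    have "card (out_neighbors G u - ?F ?S') \<le> card (N - A)"
      using FS AF finN by (intro card_mono) (auto simp: N_def)
    also have "\<dots> = k" using A \<open>k < card N\<close> by (simp add: card_Diff_subset)
    finally have "out_neighbors G u \<subseteq> ?F ?S'"
      using u FS by (intro finally_colored_closed) auto
    then have "?F S \<union> N \<subseteq> ?F ?S'" using FS by (auto simp: N_def)
    then have "card (?F S \<union> N) \<le> card (?F ?S')"
      using finF S' by (intro card_mono) auto
    moreover have "card (?F S \<union> N) = card (?F S) + card N"
      using finN finite_subset[OF sub] by (intro card_Un_disjoint) (auto simp: N_def)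
    ultimately have cF: "card (?F S) + card N \<le> card (?F ?S')" by simp
    have "d * card ?S' \<le> d * (card S + (card N - k))"
      using card_Un_le[of S A] A by simp
    also have "\<dots> \<le> (d - k) * card (?F S) + k + d * (card N - k)"
      using S by (simp add: P_def distrib_left)
    \<comment> \<open>After expanding, this is \<open>k * card N \<le> d * k\<close>, the only place
      where the degree bound enters the estimate.\<close>
    also have "d * (card N - k) \<le> (d - k) * card N"
      using \<open>card N \<le> d\<close> by (simp add: diff_mult_distrib diff_mult_distrib2 diff_le_mono2)
    finally have "d * card ?S' \<le> (d - k) * (card (?F S) + card N) + k"
      by (simp add: distrib_left)
    also have "\<dots> \<le> (d - k) * card (?F ?S') + k" using cF by simp
    finally have "P ?S'" using S' by (simp add: P_def)
    then show False using max[of ?S'] cF \<open>k < card N\<close> by simp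
  qed
  \<comment> \<open>Being closed under out-neighbors and containing \<open>r\<close>, the final
    coloring absorbs every walk from \<open>r\<close>.\<close>
  have "w \<in> ?F S" if "r \<rightarrow>\<^sup>* w" for w
    using that
  proof (induction rule: reachable_induct)
    case base
    then show ?case using S \<open>S \<subseteq> ?F S\<close> by (auto simp: P_def)
  next
    case (step x y)
    then show ?case using closed[of x] by (auto simp: out_neighbors_def)
  qed
  then have "?F S = verts G" using r sub by blast
  then show ?thesis using S by (auto simp: P_def k_forcing_set_def intro!: exI[of _ S])
qed

section \<open>The forcing number as a minimum, and the upper bound\<close>

lemma finite_k_forcing_sets: "finite {S. k_forcing_set G k S}"
  by (rule finite_subset[of _ "Pow (verts G)"]) (auto simp: k_forcing_set_def)

lemma k_forcing_number_le: "k_forcing_set G k S \<Longrightarrow> k_forcing_number k G \<le> card S"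
  unfolding k_forcing_number_def using finite_k_forcing_sets by (intro Min_le) auto

lemma k_forcing_number_attained:
  assumes "verts G \<noteq> {}"
  obtains S where "k_forcing_set G k S" "k_forcing_number k G = card S"
proof -
  have "k_forcing_set G k (verts G)"
    using assms finally_colored_subset_verts[of "verts G" k]
      finally_colored_increasing[of "verts G" G k]
    by (auto simp: k_forcing_set_def)
  then have "k_forcing_number k G \<in> card ` {S. k_forcing_set G k S}"
    unfolding k_forcing_number_def using finite_k_forcing_sets by (intro Min_in) auto
  then show ?thesis using that by auto
qed

lemma k_forcing_number_bound:
  assumes "reachable_digraph G" "0 < k" "k \<le> max_out_degree G"
  shows "real (k_forcing_number k G) \<le>
    ((real (max_out_degree G) - real k) * real (order G) + real k) / real (max_out_degree G)"
proof -
  let ?d = "max_out_degree G"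
  obtain r where "r \<in> verts G" "\<And>w. w \<in> verts G \<Longrightarrow> r \<rightarrow>\<^sup>* w"
    using assms by (auto simp: reachable_digraph_def)
  then obtain S where S: "k_forcing_set G k S" "?d * card S \<le> (?d - k) * order G + k"
    using exists_forcing_set_bound[of r ?d k] out_degree_le_max assms(3) by (auto simp: order_def)
  have "?d * k_forcing_number k G \<le> ?d * card S"
    using k_forcing_number_le[OF S(1)] by simp
  with S(2) have "?d * k_forcing_number k G \<le> (?d - k) * order G + k" by linarith
  then have "real (?d * k_forcing_number k G) \<le> real ((?d - k) * order G + k)"
    by (rule of_nat_mono)
  \<comment> \<open>The hypotheses on \<open>k\<close> make the truncated subtraction agree with the
    real one and the denominator positive.\<close>
  then show ?thesis using assms by (simp add: of_nat_diff field_simps)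
qed

end

section \<open>Out-stars and sharpness\<close>

definition out_star :: "nat \<Rightarrow> (nat, nat \<times> nat) pre_digraph" where
  "out_star d = \<lparr>verts = {..d}, arcs = {0} \<times> {1..d}, tail = fst, head = snd\<rparr>"

lemma out_star_dominates: "u \<rightarrow>\<^bsub>out_star d\<^esub> v \<longleftrightarrow> u = 0 \<and> v \<in> {1..d}"
  by (force simp: out_star_def arcs_ends_def arc_to_ends_def)

lemma digraph_out_star: "digraph (out_star d)"
  by unfold_locales (auto simp: out_star_def arc_to_ends_def)

lemma oriented_graph_out_star: "oriented_graph (out_star d)"
  by (simp add: oriented_graph_def digraph_out_star out_star_dominates)

lemma reachable_digraph_out_star: "reachable_digraph (out_star d)"
proof -
  interpret digraph "out_star d" by (rule digraph_out_star)
  have "0 \<rightarrow>\<^sup>*\<^bsub>out_star d\<^esub> w" if "w \<in> verts (out_star d)" for w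
  proof (cases "w = 0")
    case True
    then show ?thesis using that by (simp add: reachable_refl)
  next
    case False
    then show ?thesis using that
      by (intro reachable_adjI) (auto simp: out_star_dominates, simp_all add: out_star_def)
  qed
  then show ?thesis by (auto simp: reachable_digraph_def out_star_def)
qed

lemma max_out_degree_out_star: "max_out_degree (out_star d) = d"
proof -
  have "out_arcs (out_star d) v = (if v = 0 then {0} \<times> {1..d} else {})" for v
    by (auto simp: out_star_def)
  then have "out_degree (out_star d) v = (if v = 0 then d else 0)" for v
    by (simp add: out_degree_def card_cartesian_product)
  then show ?thesis
    unfolding max_out_degree_def by (intro Max_eqI) (auto simp: out_star_def)
qed

lemma card_k_forcing_set_out_star:
  assumes "k_forcing_set (out_star d) k S"
  shows "d + 1 \<le> card S + k"
proof -
  let ?D = "out_star d"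
  have V: "verts ?D = {..d}" by (simp add: out_star_def)
  have nb: "out_neighbors ?D v = (if v = 0 then {1..d} else {})" for v
    by (auto simp: out_neighbors_def out_star_dominates)
  have S: "S \<subseteq> {..d}" "finally_colored ?D k S = {..d}"
    using assms by (auto simp: k_forcing_set_def V)
  \<comment> \<open>The centre is nobody's out-neighbor, so it is never forced.\<close>
  have "0 \<notin> finally_colored ?D k S" if "0 \<notin> S"
    by (rule finally_colored_induct) (use that in \<open>auto simp: force_step_def nb\<close>)
  then have "0 \<in> S" using S by auto
  then have "card ({1..d} - S) = card ({..d} - S)"
    by (intro arg_cong[where f = card]) (auto simp: Suc_le_eq intro: gr0I)
  also have "\<dots> = d + 1 - card S" using S by (simp add: card_Diff_subset finite_subset)
  finally have c: "card ({1..d} - S) = d + 1 - card S" .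
  show ?thesis
  proof (cases "card ({1..d} - S) \<le> k")
    case True
    then show ?thesis using c by simp
  next
    case False
    \<comment> \<open>Only the centre has out-neighbors, and too many of them are non-colored, so
      the first step changes nothing and \<open>S\<close> must already be everything.\<close>
    have "finally_colored ?D k S = S"
      by (rule finally_colored_induct) (use False in \<open>auto simp: force_step_def nb\<close>)
    then show ?thesis using S False by auto
  qed
qed

text \<open>The general bound gives one inequality; the count of initially colored vertices, applied
  to a minimum forcing set, gives the other.\<close>

lemma k_forcing_number_out_star:
  assumes "0 < k" "k \<le> d"
  shows "real (k_forcing_number k (out_star d)) =
    ((real d - real k) * real (order (out_star d)) + real k) / real d"
proof (rule antisym)
  interpret digraph "out_star d" by (rule digraph_out_star)
  show "real (k_forcing_number k (out_star d)) \<le>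
    ((real d - real k) * real (order (out_star d)) + real k) / real d"
    using k_forcing_number_bound[of k] reachable_digraph_out_star assms
    by (simp add: max_out_degree_out_star)
  have "verts (out_star d) \<noteq> {}" by (simp add: out_star_def)
  then have "d + 1 \<le> k_forcing_number k (out_star d) + k"
    using k_forcing_number_attained card_k_forcing_set_out_star by metis
  then have "real d + 1 - real k \<le> real (k_forcing_number k (out_star d))"
    by linarith
  moreover have "order (out_star d) = d + 1" by (simp add: order_def out_star_def)
  \<comment> \<open>For order \<open>d + 1\<close> the numerator factors as
    \<open>d * (d + 1 - k)\<close>.\<close>
  moreover have "((real d - real k) * (1 + real d) + real k) / real d = real d + 1 - real k"
    using assms by (simp add: field_simps)
  ultimately show "((real d - real k) * real (order (out_star d)) + real k) / real d
      \<le> real (k_forcing_number k (out_star d))"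
    by simp
qed

text \<open>Sharpness is shown for every admissible pair of \<open>k\<close> and \<Delta>, not for a
  single example. Its witnesses live on \<open>nat\<close>, since an arbitrary vertex type may have
  too few elements for an out-star with \<Delta> leaves.\<close>

theorem theorem2p9:
  shows "(\<forall>(D :: ('a, 'b) pre_digraph) (k :: nat).
            oriented_graph D \<and> reachable_digraph D \<and> 0 < k \<and> k \<le> max_out_degree D \<longrightarrow>
            real (k_forcing_number k D) \<le>
              ((real (max_out_degree D) - real k) * real (order D) + real k)
                / real (max_out_degree D))
       \<and> (\<forall>(k :: nat) (\<Delta> :: nat). 0 < k \<and> k \<le> \<Delta> \<longrightarrow>
            (\<exists>D :: (nat, nat \<times> nat) pre_digraph.
               oriented_graph D \<and> reachable_digraph D \<and> max_out_degree D = \<Delta> \<and>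
               real (k_forcing_number k D) =
                 ((real \<Delta> - real k) * real (order D) + real k) / real \<Delta>))"
proof (intro conjI allI impI)
  fix D :: "('a, 'b) pre_digraph" and k :: nat
  assume D: "oriented_graph D \<and> reachable_digraph D \<and> 0 < k \<and> k \<le> max_out_degree D"
  then interpret digraph D by (simp add: oriented_graph_def)
  show "real (k_forcing_number k D) \<le>
    ((real (max_out_degree D) - real k) * real (order D) + real k) / real (max_out_degree D)"
    using D by (intro k_forcing_number_bound) auto
next
  fix k \<Delta> :: nat
  assume "0 < k \<and> k \<le> \<Delta>"
  then show "\<exists>D :: (nat, nat \<times> nat) pre_digraph.
      oriented_graph D \<and> reachable_digraph D \<and> max_out_degree D = \<Delta> \<and>
      real (k_forcing_number k D) = ((real \<Delta> - real k) * real (order D) + real k) / real \<Delta>"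
    by (intro exI[of _ "out_star \<Delta>"])
      (simp add: oriented_graph_out_star reachable_digraph_out_star max_out_degree_out_star
        k_forcing_number_out_star)
qed

end
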